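(* Let $d \geq 1$ be an odd integer and let $n \geq d$ be an integer. Then $$\operatorname{rank}(\sigma_{d,n}) \leq \sum_{i=0}^{(d-1)/2} \binom{n}{i}.$$
   Context: $\sigma_{d,n} = \sum_{I \subset \{1,\dots,n\}, |I| = d} \prod_{i \in I} x_i \in \mathbb{C}[x_1,\dots,x_n]$ is the elementary symmetric polynomial of degree $d$ in $n$ variables. For a form (homogeneous polynomial) $F \in \mathbb{C}[x_1,\dots,x_n]$ of degree $d$, its (symmetric tensor) rank $\operatorname{rank}(F)$ is the least integer $s$ such that $F = \sum_{i=1}^s L_i^d$ for some linear forms $L_1,\dots,L_s \in \mathbb{C}[x_1,\dots,x_n]$. *)

theory Defs
  imports Complex_Main "HOL-Library.Poly_Mapping" "HOL-Library.Extended_Nat"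
begin

text \<open>
  Polynomials over \<open>\<complex>\<close> are finitely supported maps from monomials to coefficients, a monomial
  being the finitely supported map sending \<open>i\<close> to the exponent of \<open>x\<^sub>i\<close>. The type has
  infinitely many variables; the ring \<open>\<complex>[x\<^sub>1,\<dots>,x\<^sub>n]\<close> consists of the polynomials all of whose
  monomials are supported on \<open>{1..n}\<close>.
\<close>

type_synonym cpoly = "(nat \<Rightarrow>\<^sub>0 nat) \<Rightarrow>\<^sub>0 complex"

definition var :: "nat \<Rightarrow> cpoly" where
  "var i = Poly_Mapping.single (Poly_Mapping.single i 1) 1"

definition mdegree :: "(nat \<Rightarrow>\<^sub>0 nat) \<Rightarrow> nat" where
  "mdegree m = (\<Sum>i\<in>Poly_Mapping.keys m. Poly_Mapping.lookup m i)"

text \<open>Forms of degree \<open>k\<close> in \<open>\<complex>[x\<^sub>1,\<dots>,x\<^sub>n]\<close>; the zero polynomial is a form of every degree.\<close>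

definition is_form :: "nat \<Rightarrow> nat \<Rightarrow> cpoly \<Rightarrow> bool" where
  "is_form n k F \<longleftrightarrow>
     (\<forall>m\<in>Poly_Mapping.keys F. Poly_Mapping.keys m \<subseteq> {1..n} \<and> mdegree m = k)"

abbreviation linear_form :: "nat \<Rightarrow> cpoly \<Rightarrow> bool" where
  "linear_form n L \<equiv> is_form n 1 L"

definition elem_sym :: "nat \<Rightarrow> nat \<Rightarrow> cpoly" where
  "elem_sym d n = (\<Sum>I | I \<subseteq> {1..n} \<and> card I = d. \<Prod>i\<in>I. var i)"

text \<open>
  The rank of a form \<open>F\<close> of degree \<open>d\<close> in \<open>\<complex>[x\<^sub>1,\<dots>,x\<^sub>n]\<close>. The value lies in \<^typ>\<open>enat\<close>, so
  it is \<open>\<infinity>\<close>, and not an arbitrary number, when \<open>F\<close> is not a sum of \<open>d\<close>-th powers of linear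
  forms; a finite upper bound on the rank thus entails that such a decomposition exists.
\<close>

definition form_rank :: "nat \<Rightarrow> nat \<Rightarrow> cpoly \<Rightarrow> enat" where
  "form_rank n d F =
     (INF s \<in> {s. \<exists>L. (\<forall>i\<in>{1..s}. linear_form n (L i)) \<and> F = (\<Sum>i=1..s. L i ^ d)}. enat s)"

lemma is_form_var: "i \<in> {1..n} \<Longrightarrow> is_form n 1 (var i)"
  by (simp add: is_form_def var_def mdegree_def)

lemma mdegree_add: "mdegree (a + b) = mdegree a + mdegree b"
proof -
  have *: "mdegree m = (\<Sum>i\<in>A. Poly_Mapping.lookup m i)"
    if "finite A" "Poly_Mapping.keys m \<subseteq> A" for m A
    unfolding mdegree_def using that by (intro sum.mono_neutral_left) (auto simp: in_keys_iff)
  let ?A = "Poly_Mapping.keys a \<union> Poly_Mapping.keys b"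
  show ?thesis
    using *[of ?A a] *[of ?A b] *[of ?A "a + b"] Poly_Mapping.keys_add[of a b]
    by (simp add: lookup_add sum.distrib)
qed

lemma is_form_mult:
  assumes "is_form n j F" "is_form n k G"
  shows "is_form n (j + k) (F * G)"
proof -
  have "Poly_Mapping.keys m \<subseteq> {1..n} \<and> mdegree m = j + k"
    if "m \<in> Poly_Mapping.keys (F * G)" for m
  proof -
    obtain a b where ab: "m = a + b" "a \<in> Poly_Mapping.keys F" "b \<in> Poly_Mapping.keys G"
      using \<open>m \<in> Poly_Mapping.keys (F * G)\<close> keys_mult[of F G] by blast
    have "Poly_Mapping.keys a \<subseteq> {1..n}" "mdegree a = j" "Poly_Mapping.keys b \<subseteq> {1..n}" "mdegree b = k"
      using assms ab unfolding is_form_def by blast+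
    with ab(1) Poly_Mapping.keys_add[of a b] show ?thesis
      by (metis mdegree_add Un_least subset_trans)
  qed
  then show ?thesis by (simp add: is_form_def)
qed

lemma is_form_sum: "(\<And>a. a \<in> A \<Longrightarrow> is_form n k (f a)) \<Longrightarrow> is_form n k (sum f A)"
  unfolding is_form_def using keys_sum[of f A] by blast

lemma is_form_elem_sym: "is_form n d (elem_sym d n)"
proof -
  have "is_form n (card I) (\<Prod>i\<in>I. var i)" if "finite I" "I \<subseteq> {1..n}" for I
    using that
  proof (induction I rule: finite_induct)
    case empty
    then show ?case by (simp add: is_form_def mdegree_def)
  next
    case (insert i I)
    then show ?case
      using is_form_mult[OF is_form_var[of i n], of "card I" "\<Prod>i\<in>I. var i"] by simp
  qed
  then show ?thesis
    unfolding elem_sym_def by (intro is_form_sum) (auto dest: finite_subset)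
qed

end

theory Submission
  imports Defs "HOL-Library.FuncSet" "HOL-Computational_Algebra.Polynomial_FPS"
begin

text \<open>
  Write \<open>d = 2 * k + 1\<close>. The bound comes from an explicit decomposition, due to Lee: for signs
  \<open>\<epsilon>\<^sub>I(i) = -1\<close> if \<open>i \<in> I\<close> and \<open>\<epsilon>\<^sub>I(i) = 1\<close> otherwise, and for suitable integers \<open>w\<close>,
  the sum over all \<open>I \<subseteq> {1..n}\<close> with \<open>card I \<le> k\<close> of
  \<open>w (card I) * (\<epsilon>\<^sub>I(1) x\<^sub>1 + \<dots> + \<epsilon>\<^sub>I(n) x\<^sub>n) ^ d\<close> equals \<open>4 ^ k * d!\<close> times the elementary
  symmetric polynomial (\<open>signed_power_sum_eq_elementary_symmetric\<close>). There are as many powers as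
  such sets \<open>I\<close>, and since \<open>d\<close> is odd every real coefficient is a \<open>d\<close>-th power and can be
  absorbed into the linear form.

  To see the identity, expand a power as a sum over words \<open>f\<close> of length \<open>d\<close>. The signs along
  \<open>f\<close> multiply to \<open>(-1) ^ card (I \<inter> T)\<close>, where \<open>T\<close> is the set of letters that
  occur an odd number of times (\<open>prod_signs_along_word\<close>). So a word contributes with the
  coefficient \<open>\<Sum>I. w (card I) * (-1) ^ card (I \<inter> T)\<close>, which only depends on
  \<open>j = card T\<close>, and \<open>j\<close> is odd because \<open>d\<close> is. We have \<open>j = d\<close> exactly for the
  injective words, which spell the squarefree monomials, each \<open>d!\<close> times
  (\<open>sum_injective_words\<close>); all other words have \<open>j \<le> 2 * k\<close>. The weights
  have to annihilate these.

  The choice of \<open>w\<close> is explained by generating functions. The sum of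
  \<open>(-1) ^ card (I \<inter> T) * (-z) ^ card I\<close> over all \<open>I\<close> is \<open>(1 + z) ^ j * (1 - z) ^ (n - j)\<close>.
  Taking for \<open>\<bar>w i\<bar>\<close> the coefficient of \<open>z ^ (k - i)\<close> in
  \<open>1 / (1 - z) ^ (n - 2 * k)\<close> cuts the sum off at \<open>card I \<le> k\<close> and makes the coefficient
  of the word equal to that of \<open>z ^ k\<close> in \<open>(1 + z) ^ j * (1 - z) ^ (2 * k - j)\<close>. For odd
  \<open>j < 2 * k\<close> this polynomial of degree \<open>2 * k\<close> is antipalindromic, so its middle coefficient
  vanishes (\<open>middle_coeff_eq_0\<close>). For \<open>j = 2 * k + 1\<close> it becomes the power series
  \<open>(1 + z) ^ (2 * k + 1) / (1 - z)\<close>, whose coefficient is half of a full row sum of binomial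
  coefficients, namely \<open>4 ^ k\<close>.
\<close>

section \<open>The weights and their character sums\<close>

unbundle fps_syntax

text \<open>
  For \<open>i \<le> k < n - k\<close> this is, up to the sign, the coefficient of \<open>z ^ (k - i)\<close> in
  \<open>1 / (1 - z) ^ (n - 2 * k)\<close>.
\<close>

definition lee_weight :: "nat \<Rightarrow> nat \<Rightarrow> nat \<Rightarrow> int" where
  "lee_weight n k i = (- 1) ^ i * int ((n - k - i - 1) choose (k - i))"

lemma sum_Pow_char:
  fixes z :: "'a :: comm_ring_1"
  assumes "finite A" "T \<subseteq> A"
  shows "(\<Sum>I\<in>Pow A. (- 1) ^ card (I \<inter> T) * (- z) ^ card I)
           = (1 + z) ^ card T * (1 - z) ^ (card A - card T)"
proof -
  have *: "(\<Prod>i\<in>I. if i \<in> T then z else - z) = (- 1) ^ card (I \<inter> T) * (- z) ^ card I"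
    if "I \<subseteq> A" for I
  proof -
    have "finite I" using that assms finite_subset by blast
    have "(\<Prod>i\<in>I. if i \<in> T then z else - z) = (\<Prod>i\<in>I. (if i \<in> T then - 1 else 1) * (- z))"
      by (intro prod.cong) auto
    also have "\<dots> = (\<Prod>i\<in>I. if i \<in> T then - 1 else 1) * (- z) ^ card I"
      by (subst prod.distrib) simp
    also have "(\<Prod>i\<in>I. if i \<in> T then - 1 else (1::'a)) = (- 1) ^ card (I \<inter> T)"
      using \<open>finite I\<close> by (simp add: prod.If_cases)
    finally show ?thesis .
  qed
  have "(\<Prod>i\<in>A. (if i \<in> T then z else - z) + 1)
          = (\<Sum>I\<in>Pow A. (- 1) ^ card (I \<inter> T) * (- z) ^ card I)"
    using assms(1) by (subst prod_add) (auto intro!: sum.cong simp: *)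
  moreover have "(\<Prod>i\<in>A. (if i \<in> T then z else - z) + 1)
          = (\<Prod>i\<in>A. if i \<in> T then 1 + z else 1 - z)"
    by (intro prod.cong) (auto simp: algebra_simps)
  moreover have "\<dots> = (1 + z) ^ card T * (1 - z) ^ (card A - card T)"
  proof -
    have "card (A \<inter> - T) = card A - card T"
      using assms by (metis Diff_eq card_Diff_subset finite_subset)
    moreover have "A \<inter> T = T" using assms by auto
    ultimately show ?thesis
      using assms(1) by (simp add: prod.If_cases)
  qed
  ultimately show ?thesis by simp
qed

text \<open>
  Reversing the coefficients turns \<open>1 - X\<close> into its negative and fixes \<open>1 + X\<close>, so a product
  with an odd number of factors \<open>1 - X\<close> is antipalindromic.
\<close>

lemma middle_coeff_eq_0:
  assumes "odd j" "j \<le> 2 * k"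
  shows "((1 + fps_X) ^ j * (1 - fps_X) ^ (2 * k - j) :: real fps) $ k = 0"
proof -
  define p :: "real poly" where "p = [:1, 1:] ^ j * [:1, - 1:] ^ (2 * k - j)"
  have deg: "degree p = 2 * k"
    using assms unfolding p_def by (simp add: degree_mult_eq degree_power_eq)
  have refl: "reflect_poly [:1, 1::real:] = [:1, 1:]" "reflect_poly [:1, - 1::real:] = - [:1, - 1:]"
    by (auto simp: reflect_poly_def)
  have odd: "odd (2 * k - j)" using assms by simp
  have "reflect_poly p = - p"
    unfolding p_def
    by (simp only: reflect_poly_mult reflect_poly_power refl power_minus_odd[OF odd] mult_minus_right)
  then have "coeff p k = - coeff p k"
    using deg coeff_reflect_poly[of p k] by simp
  then have "fps_of_poly p $ k = 0" by simp
  also have "fps_of_poly p = (1 + fps_X) ^ j * (1 - fps_X) ^ (2 * k - j)"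
    unfolding p_def by (simp add: fps_of_poly_mult fps_of_poly_power fps_of_poly_pCons fps_of_poly_simps)
  finally show ?thesis .
qed

lemma half_row_sum_coeff:
  "((1 + fps_X) ^ (2 * k + 1) * inverse (1 - fps_X) :: real fps) $ k = 4 ^ k"
proof -
  have "((1 + fps_X) ^ (2 * k + 1) * inverse (1 - fps_X) :: real fps) $ k
        = (\<Sum>i\<le>k. real ((2 * k + 1) choose i))"
  proof -
    have "inverse (1 - fps_X :: real fps) = Abs_fps (\<lambda>_. 1)"
      using one_minus_const_fps_X_neg_power'[of 1 "1::real"] by simp
    moreover have "(1 + fps_X :: real fps) ^ (2 * k + 1) = fps_binomial (of_nat (2 * k + 1))"
      by (rule fps_binomial_of_nat [symmetric])
    ultimately show ?thesis
      by (simp add: fps_mult_nth binomial_gbinomial atMost_atLeast0 del: of_nat_Suc of_nat_add)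
  qed
  also have "\<dots> = real (\<Sum>i\<le>k. (2 * k + 1) choose i)" by simp
  also have "\<dots> = 4 ^ k" by (simp only: binomial_r_part_sum) (simp add: power_mult)
  finally show ?thesis .
qed

text \<open>
  Here the weights do their work: multiplying the generating function of the characters
  by \<open>1 / (1 - X) ^ (n - 2 * k)\<close> and reading off the coefficient of \<open>X ^ k\<close> produces exactly the
  weighted sum over the sets of size at most \<open>k\<close>.
\<close>

lemma lee_weight_char_sum:
  assumes "finite A" "T \<subseteq> A" "odd (card T)" "card T \<le> 2 * k + 1" "2 * k + 1 \<le> card A"
  shows "(\<Sum>I | I \<subseteq> A \<and> card I \<le> k. lee_weight (card A) k (card I) * (- 1) ^ card (I \<inter> T))
           = (if card T = 2 * k + 1 then 4 ^ k else 0)"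
proof -
  define n where "n = card A"
  define j where "j = card T"
  define G :: "real fps" where "G = inverse ((1 - fps_X) ^ (n - 2 * k))"
  have n: "2 * k + 1 \<le> n" "j \<le> n"
    using assms by (auto simp: n_def j_def card_mono)
  have unit: "(1 - fps_X) ^ m * inverse ((1 - fps_X :: real fps) ^ m) = 1" for m
    by (intro inverse_mult_eq_1') (simp add: fps_nth_power_0)
  have G_nth: "G $ l = real ((n - 2 * k + l - 1) choose l)" for l
    using one_minus_const_fps_X_neg_power'[of "n - 2 * k" "1::real"] n by (simp add: G_def)
  \<comment> \<open>The factor \<open>X ^ i\<close> shifts the coefficients of \<open>G\<close>, so sets with more than \<open>k\<close>
    elements drop out of the coefficient of \<open>X ^ k\<close>.\<close>
  have weighted_term: "((- 1) ^ c * (- fps_X) ^ i * G) $ k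
      = (if i \<le> k then real_of_int (lee_weight n k i * (- 1) ^ c) else 0)" for c i
  proof -
    have sign: "(- 1 :: real fps) ^ m = fps_const ((- 1) ^ m)" for m
      by (simp flip: fps_const_power fps_const_neg)
    have "(- 1) ^ c * (- fps_X) ^ i * G = fps_const ((- 1) ^ c * (- 1) ^ i) * (fps_X ^ i * G)"
      by (simp only: power_minus[of fps_X i] sign fps_const_mult[symmetric] mult.assoc)
    then have *: "((- 1) ^ c * (- fps_X) ^ i * G) $ k
        = (- 1) ^ c * (- 1) ^ i * (if k < i then 0 else G $ (k - i))"
      by (simp only: fps_mult_left_const_nth fps_X_power_mult_nth)
    have "n - 2 * k + (k - i) - 1 = n - k - i - 1" if "i \<le> k"
      using n that by simp
    then show ?thesis
      unfolding * by (auto simp: G_nth lee_weight_def)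
  qed
  have "real_of_int (\<Sum>I | I \<subseteq> A \<and> card I \<le> k. lee_weight n k (card I) * (- 1) ^ card (I \<inter> T))
      = (\<Sum>I\<in>Pow A. if card I \<le> k
           then real_of_int (lee_weight n k (card I) * (- 1) ^ card (I \<inter> T)) else 0)"
    using assms(1) by (simp add: sum.inter_filter[symmetric])
  also have "\<dots> = (\<Sum>I\<in>Pow A. ((- 1) ^ card (I \<inter> T) * (- fps_X) ^ card I * G) $ k)"
    by (simp only: weighted_term)
  also have "\<dots> = ((\<Sum>I\<in>Pow A. (- 1) ^ card (I \<inter> T) * (- fps_X) ^ card I) * G) $ k"
    by (simp add: fps_sum_nth sum_distrib_right)
  also have "\<dots> = ((1 + fps_X) ^ j * (1 - fps_X) ^ (n - j) * G) $ k"
    using sum_Pow_char[OF assms(1,2), of "fps_X :: real fps"] by (simp add: n_def j_def)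
  also have "\<dots> = (if j = 2 * k + 1 then 4 ^ k else 0)"
  proof (cases "j = 2 * k + 1")
    case True
    have "inverse (1 - fps_X) = (1 - fps_X) ^ (n - j) * G"
    proof -
      have "n - 2 * k = (n - j) + 1" using n True by simp
      then have "G = inverse ((1 - fps_X) ^ (n - j)) * inverse (1 - fps_X)"
        unfolding G_def by (simp add: fps_inverse_mult)
      then show ?thesis using unit[of "n - j"] by (simp flip: mult.assoc)
    qed
    then show ?thesis using True half_row_sum_coeff[of k] by (simp add: mult.assoc)
  next
    case False
    then have j: "j \<le> 2 * k" using assms by (simp add: j_def)
    have "(1 - fps_X) ^ (n - j) * G = (1 - fps_X) ^ (2 * k - j)"
    proof -
      have "n - j = (2 * k - j) + (n - 2 * k)" using n j by simp
      then show ?thesis using unit[of "n - 2 * k"] by (simp add: G_def power_add mult.assoc)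
    qed
    then show ?thesis using False middle_coeff_eq_0[of j k] assms(3) j
      by (simp add: mult.assoc j_def)
  qed
  also have "\<dots> = real_of_int (if card T = 2 * k + 1 then 4 ^ k else 0)"
    by (simp add: j_def)
  finally show ?thesis
    unfolding of_int_eq_iff by (simp add: n_def)
qed

section \<open>Words and the letters of odd multiplicity\<close>

definition odd_letters :: "('t \<Rightarrow> 'a) \<Rightarrow> 't set \<Rightarrow> 'a set" where
  "odd_letters f D = {i \<in> f ` D. odd (card {t \<in> D. f t = i})}"

lemma odd_card_inter_odd_letters:
  assumes "finite D" "finite I"
  shows "odd (card (I \<inter> odd_letters f D)) \<longleftrightarrow> odd (card {t \<in> D. f t \<in> I})"
proof -
  have "{t \<in> D. f t \<in> I} = (\<Union>i\<in>I. {t \<in> D. f t = i})" by auto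
  also have "card \<dots> = (\<Sum>i\<in>I. card {t \<in> D. f t = i})"
    using assms by (intro card_UN_disjoint) auto
  finally have "odd (card {t \<in> D. f t \<in> I}) \<longleftrightarrow> odd (card {i \<in> I. odd (card {t \<in> D. f t = i})})"
    using even_sum_iff[OF assms(2)] by simp
  moreover have "{i \<in> I. odd (card {t \<in> D. f t = i})} = I \<inter> odd_letters f D"
  proof -
    have "i \<in> f ` D" if "odd (card {t \<in> D. f t = i})" for i
    proof (rule ccontr)
      assume "i \<notin> f ` D"
      then have "{t \<in> D. f t = i} = {}" by auto
      with that show False by (metis card.empty even_zero)
    qed
    then show ?thesis unfolding odd_letters_def by blast
  qed
  ultimately show ?thesis by simp
qed

lemma odd_card_odd_letters:
  assumes "finite D"
  shows "odd (card (odd_letters f D)) \<longleftrightarrow> odd (card D)"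
proof -
  have "f ` D \<inter> odd_letters f D = odd_letters f D" by (auto simp: odd_letters_def)
  moreover have "{t \<in> D. f t \<in> f ` D} = D" by auto
  ultimately show ?thesis using odd_card_inter_odd_letters[of D "f ` D" f] assms by simp
qed

lemma card_odd_letters_le:
  assumes "finite D"
  shows "card (odd_letters f D) \<le> card D"
  by (rule order_trans[OF card_mono card_image_le]) (use assms in \<open>auto simp: odd_letters_def\<close>)

lemma card_odd_letters_eq_iff_inj_on:
  assumes "finite D"
  shows "card (odd_letters f D) = card D \<longleftrightarrow> inj_on f D"
proof
  assume "card (odd_letters f D) = card D"
  moreover have "card (odd_letters f D) \<le> card (f ` D)"
    using assms by (intro card_mono) (auto simp: odd_letters_def)
  ultimately show "inj_on f D"
    using assms card_image_le[of D f] by (intro eq_card_imp_inj_on) auto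
next
  assume inj: "inj_on f D"
  have "{t \<in> D. f t = f s} = {s}" if "s \<in> D" for s
    using that inj by (auto dest: inj_onD)
  then have "odd_letters f D = f ` D" unfolding odd_letters_def by auto
  then show "card (odd_letters f D) = card D" using inj by (simp add: card_image)
qed

lemma prod_signs_along_word:
  fixes x :: "'a \<Rightarrow> 'b :: comm_ring_1"
  assumes "finite D" "finite I"
  shows "(\<Prod>t\<in>D. if f t \<in> I then - x (f t) else x (f t))
           = (- 1) ^ card (I \<inter> odd_letters f D) * (\<Prod>t\<in>D. x (f t))"
proof -
  have "(\<Prod>t\<in>D. if f t \<in> I then - x (f t) else x (f t))
          = (\<Prod>t\<in>D. (if f t \<in> I then - 1 else 1) * x (f t))"
    by (intro prod.cong) auto
  also have "\<dots> = (\<Prod>t\<in>D. if f t \<in> I then - 1 else 1) * (\<Prod>t\<in>D. x (f t))"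
    by (rule prod.distrib)
  also have "(\<Prod>t\<in>D. if f t \<in> I then - 1 else (1::'b)) = (- 1) ^ card {t \<in> D. f t \<in> I}"
    using assms by (simp add: prod.If_cases Int_def)
  also have "\<dots> = (- 1) ^ card (I \<inter> odd_letters f D)"
    using odd_card_inter_odd_letters[OF assms, of f] by (simp add: minus_one_power_iff)
  finally show ?thesis .
qed

lemma power_sum_eq_sum_words:
  fixes y :: "'a \<Rightarrow> 'b :: comm_semiring_1"
  assumes "finite A"
  shows "(\<Sum>i\<in>A. y i) ^ d = (\<Sum>f\<in>{..<d} \<rightarrow>\<^sub>E A. \<Prod>t<d. y (f t))"
  using prod_sum_PiE[of "{..<d}" "\<lambda>_. A" "\<lambda>_. y"] assms by simp

text \<open>
  Grouping the injective words by the set \<open>T\<close> of their letters, the monomial of \<open>T\<close> arises once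
  for each of the \<open>d!\<close> orderings of \<open>T\<close>.
\<close>

lemma sum_injective_words:
  fixes x :: "'a \<Rightarrow> 'b :: comm_semiring_1"
  assumes "finite A"
  shows "(\<Sum>f | f \<in> {..<d} \<rightarrow>\<^sub>E A \<and> inj_on f {..<d}. \<Prod>t<d. x (f t))
           = of_nat (fact d) * (\<Sum>T | T \<subseteq> A \<and> card T = d. \<Prod>i\<in>T. x i)"
proof -
  define W where "W = {f. f \<in> {..<d} \<rightarrow>\<^sub>E A \<and> inj_on f {..<d}}"
  have "finite W"
    unfolding W_def
    by (rule finite_subset[of _ "{..<d} \<rightarrow>\<^sub>E A"]) (use assms in \<open>simp_all add: finite_PiE subset_iff\<close>)
  have W_image: "(\<lambda>f. f ` {..<d}) ` W \<subseteq> {T. T \<subseteq> A \<and> card T = d}"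
    unfolding W_def PiE_iff by (auto simp: card_image)
  have count: "card {f \<in> W. f ` {..<d} = T} = fact d" if T: "T \<subseteq> A" "card T = d" for T
  proof -
    have "finite T" using T assms finite_subset by blast
    have "{f \<in> W. f ` {..<d} = T} = {f \<in> {..<d} \<rightarrow>\<^sub>E T. inj_on f {..<d}}"
    proof (intro equalityI subsetI)
      fix f assume "f \<in> {f \<in> {..<d} \<rightarrow>\<^sub>E T. inj_on f {..<d}}"
      then have f: "f \<in> {..<d} \<rightarrow>\<^sub>E T" "inj_on f {..<d}" by simp_all
      then have "f ` {..<d} \<subseteq> T" "card (f ` {..<d}) = card T"
        using T by (auto simp: PiE_iff card_image)
      then have "f ` {..<d} = T" using \<open>finite T\<close> by (intro card_subset_eq)
      with f T(1) show "f \<in> {f \<in> W. f ` {..<d} = T}"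
        unfolding W_def PiE_iff by blast
    next
      fix f assume "f \<in> {f \<in> W. f ` {..<d} = T}"
      then show "f \<in> {f \<in> {..<d} \<rightarrow>\<^sub>E T. inj_on f {..<d}}"
        unfolding W_def PiE_iff by blast
    qed
    then show ?thesis
      using card_inj_on_subset_funcset[of "{..<d}" T "{..<d}"] \<open>finite T\<close> T
      by (simp add: fact_prod_rev)
  qed
  have "(\<Sum>f\<in>W. \<Prod>t<d. x (f t)) = (\<Sum>f\<in>W. \<Prod>i\<in>f ` {..<d}. x i)"
    by (intro sum.cong) (auto simp: W_def prod.reindex)
  also have "\<dots> = (\<Sum>T | T \<subseteq> A \<and> card T = d. \<Sum>f\<in>{f \<in> W. f ` {..<d} = T}. \<Prod>i\<in>f ` {..<d}. x i)"
    using \<open>finite W\<close> assms W_image by (intro sum.group[symmetric]) auto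
  also have "\<dots> = (\<Sum>T | T \<subseteq> A \<and> card T = d. of_nat (fact d) * (\<Prod>i\<in>T. x i))"
    by (intro sum.cong) (auto simp: count simp del: of_nat_fact)
  finally show ?thesis by (simp add: W_def sum_distrib_left del: of_nat_fact)
qed

section \<open>The decomposition into powers of signed sums\<close>

text \<open>
  Expanding the powers and exchanging the sums gives each word the character sum of its odd letters
  as coefficient. The set of odd letters has odd size at most \<open>2 * k + 1\<close>, so only the injective
  words survive.
\<close>

theorem signed_power_sum_eq_elementary_symmetric:
  fixes x :: "'a \<Rightarrow> 'b :: comm_ring_1"
  assumes "finite A" "2 * k + 1 \<le> card A"
  shows "(\<Sum>I | I \<subseteq> A \<and> card I \<le> k.
            of_int (lee_weight (card A) k (card I))
              * (\<Sum>i\<in>A. if i \<in> I then - x i else x i) ^ (2 * k + 1))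
         = 4 ^ k * of_nat (fact (2 * k + 1)) * (\<Sum>T | T \<subseteq> A \<and> card T = 2 * k + 1. \<Prod>i\<in>T. x i)"
proof -
  define d where "d = 2 * k + 1"
  define w where "w I = lee_weight (card A) k (card I)" for I :: "'a set"
  define S where "S = {I. I \<subseteq> A \<and> card I \<le> k}"
  let ?T = "\<lambda>f. odd_letters f {..<d}"
  have coeff: "(\<Sum>I\<in>S. w I * (- 1) ^ card (I \<inter> ?T f)) = (if inj_on f {..<d} then 4 ^ k else 0)"
    if "f \<in> {..<d} \<rightarrow>\<^sub>E A" for f
  proof -
    have "?T f \<subseteq> A" using that by (auto simp: odd_letters_def)
    moreover have "odd (card (?T f))" by (simp add: odd_card_odd_letters) (simp add: d_def)
    moreover have "card (?T f) \<le> d" using card_odd_letters_le[of "{..<d}" f] by simp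
    moreover have "card (?T f) = d \<longleftrightarrow> inj_on f {..<d}"
      using card_odd_letters_eq_iff_inj_on[of "{..<d}" f] by simp
    ultimately show ?thesis
      using lee_weight_char_sum[of A "?T f" k] assms unfolding w_def S_def d_def by simp
  qed
  have "(\<Sum>I\<in>S. of_int (w I) * (\<Sum>i\<in>A. if i \<in> I then - x i else x i) ^ d)
      = (\<Sum>I\<in>S. \<Sum>f\<in>{..<d} \<rightarrow>\<^sub>E A. of_int (w I * (- 1) ^ card (I \<inter> ?T f)) * (\<Prod>t<d. x (f t)))"
  proof (intro sum.cong refl)
    fix I assume "I \<in> S"
    then have "finite I" using assms(1) by (auto simp: S_def dest: finite_subset)
    then show "of_int (w I) * (\<Sum>i\<in>A. if i \<in> I then - x i else x i) ^ d
        = (\<Sum>f\<in>{..<d} \<rightarrow>\<^sub>E A. of_int (w I * (- 1) ^ card (I \<inter> ?T f)) * (\<Prod>t<d. x (f t)))"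
      by (simp add: power_sum_eq_sum_words[OF assms(1)] prod_signs_along_word
            sum_distrib_left mult.assoc)
  qed
  also have "\<dots> = (\<Sum>f\<in>{..<d} \<rightarrow>\<^sub>E A.
      of_int (\<Sum>I\<in>S. w I * (- 1) ^ card (I \<inter> ?T f)) * (\<Prod>t<d. x (f t)))"
    by (subst sum.swap) (simp add: sum_distrib_right)
  also have "\<dots> = (\<Sum>f\<in>{..<d} \<rightarrow>\<^sub>E A. if inj_on f {..<d} then 4 ^ k * (\<Prod>t<d. x (f t)) else 0)"
    by (intro sum.cong refl) (simp only: coeff, simp)
  also have "\<dots> = 4 ^ k * (\<Sum>f | f \<in> {..<d} \<rightarrow>\<^sub>E A \<and> inj_on f {..<d}. \<Prod>t<d. x (f t))"
    using assms(1) by (simp add: sum.If_cases finite_PiE sum_distrib_left Int_def)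
  also have "\<dots> = 4 ^ k * of_nat (fact d) * (\<Sum>T | T \<subseteq> A \<and> card T = d. \<Prod>i\<in>T. x i)"
    by (simp only: sum_injective_words[OF assms(1)] mult.assoc)
  finally show ?thesis by (simp add: d_def w_def S_def del: of_nat_fact fact_Suc)
qed

section \<open>Rank bounds from decompositions\<close>

lemma is_form_const: "is_form n 0 (Poly_Mapping.single 0 c)"
  by (simp add: is_form_def mdegree_def)

lemma single_0_power: "Poly_Mapping.single 0 c ^ m = (Poly_Mapping.single 0 (c ^ m) :: cpoly)"
  by (induction m) (simp_all add: mult_single)

lemma is_form_uminus: "is_form n k F \<Longrightarrow> is_form n k (- F)"
  by (simp add: is_form_def)

lemma form_rank_le_card:
  assumes "finite S" "\<And>I. I \<in> S \<Longrightarrow> linear_form n (L I)" "F = (\<Sum>I\<in>S. L I ^ d)"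
  shows "form_rank n d F \<le> enat (card S)"
proof -
  obtain h where h: "bij_betw h {1..card S} S"
    using ex_bij_betw_nat_finite_1[OF assms(1)] by blast
  have "F = (\<Sum>i=1..card S. (L \<circ> h) i ^ d)"
    unfolding assms(3) using sum.reindex_bij_betw[OF h, of "\<lambda>I. L I ^ d"] by simp
  moreover have "\<forall>i\<in>{1..card S}. linear_form n ((L \<circ> h) i)"
    using h assms(2) by (auto simp: bij_betw_def)
  ultimately show ?thesis
    unfolding form_rank_def by (intro INF_lower) blast
qed

text \<open>
  For odd \<open>d\<close> every real number has a real \<open>d\<close>-th root, so real coefficients in
  front of \<open>d\<close>-th powers are harmless.
\<close>

lemma form_rank_le_card_weighted:
  fixes c :: "'i \<Rightarrow> real"
  assumes "odd d" "finite S" "\<And>I. I \<in> S \<Longrightarrow> linear_form n (L I)"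
    and "F = (\<Sum>I\<in>S. Poly_Mapping.single 0 (complex_of_real (c I)) * L I ^ d)"
  shows "form_rank n d F \<le> enat (card S)"
proof (rule form_rank_le_card)
  let ?L = "\<lambda>I. Poly_Mapping.single 0 (complex_of_real (root d (c I))) * L I"
  show "linear_form n (?L I)" if "I \<in> S" for I
    using is_form_mult[OF is_form_const assms(3)[OF that]] by simp
  have "?L I ^ d = Poly_Mapping.single 0 (complex_of_real (c I)) * L I ^ d" for I
    using assms(1)
    by (simp add: power_mult_distrib single_0_power odd_real_root_pow flip: of_real_power)
  then show "F = (\<Sum>I\<in>S. ?L I ^ d)" by (simp add: assms(4))
qed (fact assms(2))

lemma card_subsets_card_le:
  assumes "finite A"
  shows "card {I. I \<subseteq> A \<and> card I \<le> k} = (\<Sum>i=0..k. card A choose i)"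
proof -
  have "{I. I \<subseteq> A \<and> card I \<le> k} = (\<Union>i\<in>{0..k}. {I. I \<subseteq> A \<and> card I = i})" by auto
  also have "card \<dots> = (\<Sum>i=0..k. card {I. I \<subseteq> A \<and> card I = i})"
    using assms by (intro card_UN_disjoint) auto
  finally show ?thesis using assms by (simp add: n_subsets)
qed

theorem corollary2p2:
  fixes d n :: nat
  assumes "d \<ge> 1" and "odd d" and "n \<ge> d"
  shows "form_rank n d (elem_sym d n) \<le> enat (\<Sum>i=0..(d - 1) div 2. n choose i)"
proof -
  define k where "k = (d - 1) div 2"
  have d: "d = 2 * k + 1" using assms(2) unfolding k_def by (auto elim!: oddE)
  define A where "A = {1..n}"
  define S where "S = {I. I \<subseteq> A \<and> card I \<le> k}"
  define w where "w I = lee_weight n k (card I)" for I :: "nat set"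
  define L where "L I = (\<Sum>i\<in>A. if i \<in> I then - var i else var i)" for I
  define N :: nat where "N = 4 ^ k * fact d"
  define C :: "complex \<Rightarrow> cpoly" where "C = Poly_Mapping.single 0"
  have C_mult: "C a * C b = C (a * b)" for a b by (simp add: C_def mult_single)
  have "N \<noteq> 0" by (simp add: N_def)
  have C_int: "C (of_int z) = of_int z" and C_nat: "C (of_nat m) = of_nat m" for z m
    by (simp_all add: C_def)
  have "of_nat N = (4 ^ k * of_nat (fact d) :: cpoly)"
    by (simp add: N_def del: of_nat_fact)
  then have "(\<Sum>I\<in>S. C (of_int (w I)) * L I ^ d) = C (of_nat N) * elem_sym d n"
    using signed_power_sum_eq_elementary_symmetric[of A k var] assms(3)
    by (simp only: C_int C_nat S_def w_def L_def elem_sym_def A_def d finite_atLeastAtMost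
        card_atLeastAtMost diff_Suc_1)
  then have "C (1 / of_nat N) * (\<Sum>I\<in>S. C (of_int (w I)) * L I ^ d)
      = C (1 / of_nat N) * C (of_nat N) * elem_sym d n" by (simp only: mult.assoc)
  also have "C (1 / of_nat N) * C (of_nat N) = 1"
    using \<open>N \<noteq> 0\<close> by (simp only: C_mult) (simp add: C_def)
  finally have "elem_sym d n = (\<Sum>I\<in>S. C (1 / of_nat N) * C (of_int (w I)) * L I ^ d)"
    by (simp add: sum_distrib_left mult.assoc)
  also have "\<dots> = (\<Sum>I\<in>S. Poly_Mapping.single 0 (complex_of_real (of_int (w I) / of_nat N)) * L I ^ d)"
    by (simp only: C_mult) (simp add: C_def)
  finally have "form_rank n d (elem_sym d n) \<le> enat (card S)"
  proof (rule form_rank_le_card_weighted[OF assms(2), rotated 2])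
    show "finite S" by (simp add: S_def A_def)
    show "linear_form n (L I)" for I
      unfolding L_def A_def
    proof (rule is_form_sum)
      fix i assume "i \<in> {1..n}"
      then have "linear_form n (var i)" by (rule is_form_var)
      then show "linear_form n (if i \<in> I then - var i else var i)"
        by (simp only: is_form_uminus split: if_split) simp
    qed
  qed
  also have "card S = (\<Sum>i=0..k. n choose i)"
    unfolding S_def by (subst card_subsets_card_le) (simp_all add: A_def)
  finally show ?thesis by (simp add: k_def)
qed

end
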